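(* Let $(\mathbb{X},\perp)$ be a $\perp$-restriction category. Then $\mathsf{DJ}[(\mathbb{X},\perp)]$ is a disjoint $\perp$-restriction category. Moreover $\mathcal{I}:(\mathbb{X},\perp)\to\mathsf{DJ}[(\mathbb{X},\perp)]$, defined on objects by $\mathcal{I}(A)=A$ and on maps by $\mathcal{I}(f)=\downarrow\!\{f\}$, is a faithful $\perp$-restriction functor.
   Context: Composition is diagrammatic: $fg$ means first $f$, then $g$. A restriction category is a category with an operator sending each $f:A\to B$ to $\overline{f}:A\to A$ such that $\overline{f}f=f$; $\overline{f}\,\overline{g}=\overline{g}\,\overline{f}$ and $\overline{\overline{g}f}=\overline{g}\,\overline{f}$ for $f:A\to B$, $g:A\to C$; and $f\overline{g}=\overline{fg}f$ for $f:A\to B$, $g:B\to C$. For parallel $f,g$: $f\le g$ iff $\overline{f}g=f$ (a partial order). A restriction idempotent is a map $e:A\to A$ with $\overline{e}=e$; $\mathcal{O}(A)$ is the set of these. Restriction zeroes: maps $0:A\to B$ with $f0=0=0f$ and $\overline{0}=0$. An interference relation $\perp$ on a restriction category with restriction zeroes is a family of relations between maps with the same domain such that: $1_A\perp 0$; $f\perp g\Rightarrow g\perp f$; $f\perp f\Rightarrow f=0$; $f'\perp g'$, $f\le f'$, $g\le g'$ imply $f\perp g$; $f\perp g\Rightarrow hfk\perp hgk'$ for all composable $h,k,k'$; $f\perp g\Rightarrow\overline{f}\perp\overline{g}$. A $\perp$-restriction category is a restriction category with restriction zeroes and a chosen interference relation $\perp$. A $\perp$-restriction functor is a functor preserving restrictions,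 restriction zeroes, and the interference relation ($f\perp g\Rightarrow\mathcal{F}(f)\perp\mathcal{F}(g)$). The $\perp$-join of a family of parallel maps $f_i$ with $f_i\perp f_j$ for $i\ne j$ is their least upper bound $\bigsqcup_if_i$ for $\le$; it is strong if $f_i\perp h$ for all $i$ implies $\bigsqcup_if_i\perp h$. A disjoint $\perp$-restriction category is a $\perp$-restriction category in which all (arbitrarily indexed) pairwise $\perp$-disjoint families of parallel maps have a $\perp$-join, $h\bigsqcup_if_i=\bigsqcup_ihf_i$ for all composable $h$, and every $\perp$-join is strong. For a set $F\subseteq\mathbb{X}(A,B)$ of pairwise $\perp$-disjoint maps (distinct members are $\perp$-disjoint), $\downarrow\!F=\{g:A\to B\mid\exists f\in F,\ g\le f\}$. The structure $\mathsf{DJ}[(\mathbb{X},\perp)]$ is: same objects as $\mathbb{X}$; maps $A\to B$ are the sets $S=\downarrow\!F$ with $F\subseteq\mathbb{X}(A,B)$ a nonempty set of pairwise $\perp$-disjoint maps; identities are $\mathcal{O}(A):A\to A$; composition $ST=\{fg\mid f\in S,\ g\in T\}$; restriction $\overline{S}=\{\overline{f}\mid f\in S\}$; restriction zeroes $\{0\}$; $S\perp T$ iff $f\perp g$ for all $f\in S$, $g\in T$; $\perp$-joins of (nonempty) pairwise $\perp$-disjoint families are unions, $\bigsqcup_iS_i=\bigcup_iS_i$ (the empty join being $\{0\}$). *)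

theory Defs
  imports Main
begin

text \<open>
  Hom-sets are indexed by their end points and need not be disjoint, so every operation on maps
  takes the objects involved as arguments. Composition is diagrammatic:
  \<open>Comp X A B C f g\<close> is \<open>f : A \<rightarrow> B\<close> followed by \<open>g : B \<rightarrow> C\<close>. The relation \<open>Perp X A B C f g\<close>
  concerns \<open>f : A \<rightarrow> B\<close> and \<open>g : A \<rightarrow> C\<close>. All fields are meaningful only on objects in \<open>Obj X\<close>
  and on maps in the respective hom-sets.
\<close>

record ('o, 'a) perp_cat =
  Obj  :: "'o set"
  Hom  :: "'o \<Rightarrow> 'o \<Rightarrow> 'a set"
  Id   :: "'o \<Rightarrow> 'a"
  Comp :: "'o \<Rightarrow> 'o \<Rightarrow> 'o \<Rightarrow> 'a \<Rightarrow> 'a \<Rightarrow> 'a"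
  Rest :: "'o \<Rightarrow> 'o \<Rightarrow> 'a \<Rightarrow> 'a"
  Zero :: "'o \<Rightarrow> 'o \<Rightarrow> 'a"
  Perp :: "'o \<Rightarrow> 'o \<Rightarrow> 'o \<Rightarrow> 'a \<Rightarrow> 'a \<Rightarrow> bool"

locale category =
  fixes X :: "('o, 'a) perp_cat"
  assumes Id_in_Hom: "A \<in> Obj X \<Longrightarrow> Id X A \<in> Hom X A A"
    and Comp_in_Hom: "\<lbrakk>A \<in> Obj X; B \<in> Obj X; C \<in> Obj X; f \<in> Hom X A B; g \<in> Hom X B C\<rbrakk>
      \<Longrightarrow> Comp X A B C f g \<in> Hom X A C"
    and Id_Comp: "\<lbrakk>A \<in> Obj X; B \<in> Obj X; f \<in> Hom X A B\<rbrakk> \<Longrightarrow> Comp X A A B (Id X A) f = f"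
    and Comp_Id: "\<lbrakk>A \<in> Obj X; B \<in> Obj X; f \<in> Hom X A B\<rbrakk> \<Longrightarrow> Comp X A B B f (Id X B) = f"
    and Comp_assoc: "\<lbrakk>A \<in> Obj X; B \<in> Obj X; C \<in> Obj X; D \<in> Obj X;
        f \<in> Hom X A B; g \<in> Hom X B C; h \<in> Hom X C D\<rbrakk>
      \<Longrightarrow> Comp X A C D (Comp X A B C f g) h = Comp X A B D f (Comp X B C D g h)"

locale restriction_category = category +
  assumes Rest_in_Hom: "\<lbrakk>A \<in> Obj X; B \<in> Obj X; f \<in> Hom X A B\<rbrakk> \<Longrightarrow> Rest X A B f \<in> Hom X A A"
    and Rest_Comp: "\<lbrakk>A \<in> Obj X; B \<in> Obj X; f \<in> Hom X A B\<rbrakk>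
      \<Longrightarrow> Comp X A A B (Rest X A B f) f = f"
    and Rest_commute: "\<lbrakk>A \<in> Obj X; B \<in> Obj X; C \<in> Obj X; f \<in> Hom X A B; g \<in> Hom X A C\<rbrakk>
      \<Longrightarrow> Comp X A A A (Rest X A B f) (Rest X A C g) = Comp X A A A (Rest X A C g) (Rest X A B f)"
    and Rest_Rest_Comp: "\<lbrakk>A \<in> Obj X; B \<in> Obj X; C \<in> Obj X; f \<in> Hom X A B; g \<in> Hom X A C\<rbrakk>
      \<Longrightarrow> Rest X A B (Comp X A A B (Rest X A C g) f) = Comp X A A A (Rest X A C g) (Rest X A B f)"
    and Comp_Rest: "\<lbrakk>A \<in> Obj X; B \<in> Obj X; C \<in> Obj X; f \<in> Hom X A B; g \<in> Hom X B C\<rbrakk>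
      \<Longrightarrow> Comp X A B B f (Rest X B C g) = Comp X A A B (Rest X A C (Comp X A B C f g)) f"

definition rest_le :: "('o, 'a) perp_cat \<Rightarrow> 'o \<Rightarrow> 'o \<Rightarrow> 'a \<Rightarrow> 'a \<Rightarrow> bool" where
  "rest_le X A B f g \<longleftrightarrow> Comp X A A B (Rest X A B f) g = f"

definition rest_idems :: "('o, 'a) perp_cat \<Rightarrow> 'o \<Rightarrow> 'a set" where
  "rest_idems X A = {e \<in> Hom X A A. Rest X A A e = e}"

locale restriction_category_with_zeroes = restriction_category +
  assumes Zero_in_Hom: "\<lbrakk>A \<in> Obj X; B \<in> Obj X\<rbrakk> \<Longrightarrow> Zero X A B \<in> Hom X A B"
    and Comp_Zero: "\<lbrakk>A \<in> Obj X; B \<in> Obj X; C \<in> Obj X; f \<in> Hom X A B\<rbrakk>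
      \<Longrightarrow> Comp X A B C f (Zero X B C) = Zero X A C"
    and Zero_Comp: "\<lbrakk>A \<in> Obj X; B \<in> Obj X; C \<in> Obj X; f \<in> Hom X B C\<rbrakk>
      \<Longrightarrow> Comp X A B C (Zero X A B) f = Zero X A C"
    and Rest_Zero: "\<lbrakk>A \<in> Obj X; B \<in> Obj X\<rbrakk> \<Longrightarrow> Rest X A B (Zero X A B) = Zero X A A"

locale perp_restriction_category = restriction_category_with_zeroes +
  assumes Id_perp_Zero: "\<lbrakk>A \<in> Obj X; B \<in> Obj X\<rbrakk> \<Longrightarrow> Perp X A A B (Id X A) (Zero X A B)"
    and perp_sym: "\<lbrakk>A \<in> Obj X; B \<in> Obj X; C \<in> Obj X; f \<in> Hom X A B; g \<in> Hom X A C;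
        Perp X A B C f g\<rbrakk> \<Longrightarrow> Perp X A C B g f"
    and perp_self: "\<lbrakk>A \<in> Obj X; B \<in> Obj X; f \<in> Hom X A B; Perp X A B B f f\<rbrakk> \<Longrightarrow> f = Zero X A B"
    and perp_down: "\<lbrakk>A \<in> Obj X; B \<in> Obj X; C \<in> Obj X;
        f \<in> Hom X A B; f' \<in> Hom X A B; g \<in> Hom X A C; g' \<in> Hom X A C;
        Perp X A B C f' g'; rest_le X A B f f'; rest_le X A C g g'\<rbrakk> \<Longrightarrow> Perp X A B C f g"
    and perp_Comp: "\<lbrakk>D \<in> Obj X; A \<in> Obj X; B \<in> Obj X; C \<in> Obj X; B' \<in> Obj X; C' \<in> Obj X;
        h \<in> Hom X D A; f \<in> Hom X A B; g \<in> Hom X A C; k \<in> Hom X B B'; k' \<in> Hom X C C';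
        Perp X A B C f g\<rbrakk>
      \<Longrightarrow> Perp X D B' C' (Comp X D A B' h (Comp X A B B' f k)) (Comp X D A C' h (Comp X A C C' g k'))"
    and perp_Rest: "\<lbrakk>A \<in> Obj X; B \<in> Obj X; C \<in> Obj X; f \<in> Hom X A B; g \<in> Hom X A C;
        Perp X A B C f g\<rbrakk> \<Longrightarrow> Perp X A A A (Rest X A B f) (Rest X A C g)"

definition perp_family :: "('o, 'a) perp_cat \<Rightarrow> 'o \<Rightarrow> 'o \<Rightarrow> 'i set \<Rightarrow> ('i \<Rightarrow> 'a) \<Rightarrow> bool" where
  "perp_family X A B I f \<longleftrightarrow>
    (\<forall>i\<in>I. f i \<in> Hom X A B) \<and> (\<forall>i\<in>I. \<forall>j\<in>I. i \<noteq> j \<longrightarrow> Perp X A B B (f i) (f j))"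

definition is_perp_join ::
    "('o, 'a) perp_cat \<Rightarrow> 'o \<Rightarrow> 'o \<Rightarrow> 'i set \<Rightarrow> ('i \<Rightarrow> 'a) \<Rightarrow> 'a \<Rightarrow> bool" where
  "is_perp_join X A B I f s \<longleftrightarrow>
    perp_family X A B I f \<and> s \<in> Hom X A B \<and> (\<forall>i\<in>I. rest_le X A B (f i) s) \<and>
    (\<forall>t\<in>Hom X A B. (\<forall>i\<in>I. rest_le X A B (f i) t) \<longrightarrow> rest_le X A B s t)"

definition strong_perp_join ::
    "('o, 'a) perp_cat \<Rightarrow> 'o \<Rightarrow> 'o \<Rightarrow> 'i set \<Rightarrow> ('i \<Rightarrow> 'a) \<Rightarrow> 'a \<Rightarrow> bool" where
  "strong_perp_join X A B I f s \<longleftrightarrow>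
    is_perp_join X A B I f s \<and>
    (\<forall>C\<in>Obj X. \<forall>h\<in>Hom X A C. (\<forall>i\<in>I. Perp X A B C (f i) h) \<longrightarrow> Perp X A B C s h)"

text \<open>
  HOL cannot quantify over index types inside a formula, so the type \<open>'i\<close> from which index sets
  are drawn is a parameter; results for arbitrarily indexed families are stated for every \<open>'i\<close>.
\<close>

definition disjoint_perp_restriction_category :: "'i itself \<Rightarrow> ('o, 'a) perp_cat \<Rightarrow> bool" where
  "disjoint_perp_restriction_category T X \<longleftrightarrow>
    perp_restriction_category X \<and>
    (\<forall>A\<in>Obj X. \<forall>B\<in>Obj X. \<forall>(I :: 'i set) f.
      perp_family X A B I f \<longrightarrow> (\<exists>s. is_perp_join X A B I f s)) \<and>
    (\<forall>D\<in>Obj X. \<forall>A\<in>Obj X. \<forall>B\<in>Obj X. \<forall>(I :: 'i set) f s. \<forall>h\<in>Hom X D A.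
      is_perp_join X A B I f s \<longrightarrow>
      is_perp_join X D B I (\<lambda>i. Comp X D A B h (f i)) (Comp X D A B h s)) \<and>
    (\<forall>A\<in>Obj X. \<forall>B\<in>Obj X. \<forall>(I :: 'i set) f s.
      is_perp_join X A B I f s \<longrightarrow> strong_perp_join X A B I f s)"

locale category_functor = dom: category X + cod: category Y
  for X :: "('o, 'a) perp_cat" and Y :: "('p, 'b) perp_cat" +
  fixes Fo :: "'o \<Rightarrow> 'p" and Fm :: "'o \<Rightarrow> 'o \<Rightarrow> 'a \<Rightarrow> 'b"
  assumes Fo_in_Obj: "A \<in> Obj X \<Longrightarrow> Fo A \<in> Obj Y"
    and Fm_in_Hom: "\<lbrakk>A \<in> Obj X; B \<in> Obj X; f \<in> Hom X A B\<rbrakk> \<Longrightarrow> Fm A B f \<in> Hom Y (Fo A) (Fo B)"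
    and Fm_Id: "A \<in> Obj X \<Longrightarrow> Fm A A (Id X A) = Id Y (Fo A)"
    and Fm_Comp: "\<lbrakk>A \<in> Obj X; B \<in> Obj X; C \<in> Obj X; f \<in> Hom X A B; g \<in> Hom X B C\<rbrakk>
      \<Longrightarrow> Fm A C (Comp X A B C f g) = Comp Y (Fo A) (Fo B) (Fo C) (Fm A B f) (Fm B C g)"

locale perp_restriction_functor =
  category_functor X Y Fo Fm + dom: perp_restriction_category X + cod: perp_restriction_category Y
  for X :: "('o, 'a) perp_cat" and Y :: "('p, 'b) perp_cat"
    and Fo :: "'o \<Rightarrow> 'p" and Fm :: "'o \<Rightarrow> 'o \<Rightarrow> 'a \<Rightarrow> 'b" +
  assumes Fm_Rest: "\<lbrakk>A \<in> Obj X; B \<in> Obj X; f \<in> Hom X A B\<rbrakk>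
      \<Longrightarrow> Fm A A (Rest X A B f) = Rest Y (Fo A) (Fo B) (Fm A B f)"
    and Fm_Zero: "\<lbrakk>A \<in> Obj X; B \<in> Obj X\<rbrakk> \<Longrightarrow> Fm A B (Zero X A B) = Zero Y (Fo A) (Fo B)"
    and Fm_perp: "\<lbrakk>A \<in> Obj X; B \<in> Obj X; C \<in> Obj X; f \<in> Hom X A B; g \<in> Hom X A C;
        Perp X A B C f g\<rbrakk> \<Longrightarrow> Perp Y (Fo A) (Fo B) (Fo C) (Fm A B f) (Fm A C g)"

definition faithful :: "('o, 'a) perp_cat \<Rightarrow> ('o \<Rightarrow> 'o \<Rightarrow> 'a \<Rightarrow> 'b) \<Rightarrow> bool" where
  "faithful X Fm \<longleftrightarrow> (\<forall>A\<in>Obj X. \<forall>B\<in>Obj X. inj_on (Fm A B) (Hom X A B))"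

definition down :: "('o, 'a) perp_cat \<Rightarrow> 'o \<Rightarrow> 'o \<Rightarrow> 'a set \<Rightarrow> 'a set" where
  "down X A B F = {g \<in> Hom X A B. \<exists>f\<in>F. rest_le X A B g f}"

definition DJ :: "('o, 'a) perp_cat \<Rightarrow> ('o, 'a set) perp_cat" where
  "DJ X = \<lparr>
    Obj = Obj X,
    Hom = (\<lambda>A B. {down X A B F |F. F \<subseteq> Hom X A B \<and> F \<noteq> {} \<and> pairwise (Perp X A B B) F}),
    Id = (\<lambda>A. rest_idems X A),
    Comp = (\<lambda>A B C S T. {Comp X A B C f g |f g. f \<in> S \<and> g \<in> T}),
    Rest = (\<lambda>A B S. {Rest X A B f |f. f \<in> S}),
    Zero = (\<lambda>A B. {Zero X A B}),
    Perp = (\<lambda>A B C S T. \<forall>f\<in>S. \<forall>g\<in>T. Perp X A B C f g)\<rparr>"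

definition DJ_join :: "('o, 'a) perp_cat \<Rightarrow> 'o \<Rightarrow> 'o \<Rightarrow> 'i set \<Rightarrow> ('i \<Rightarrow> 'a set) \<Rightarrow> 'a set" where
  "DJ_join X A B I S = (if I = {} then {Zero X A B} else (\<Union>i\<in>I. S i))"

definition DJ_incl :: "('o, 'a) perp_cat \<Rightarrow> 'o \<Rightarrow> 'o \<Rightarrow> 'a \<Rightarrow> 'a set" where
  "DJ_incl X A B f = down X A B {f}"

end

theory Submission imports Defs begin

text \<open>
  Any two members of a map \<open>S = \<down>F\<close> of \<open>DJ X\<close> either lie below a common member of \<open>S\<close> or are
  disjoint. In both cases they are compatible: the restriction of each to the domain of the other
  is the same map. Compatibility makes the restriction order of \<open>DJ X\<close> coincide with inclusion of
  sets, so joins are unions, and it yields the one restriction axiom, \<open>Comp_Rest\<close>, that does not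
  hold for sets of maps merely because it holds for their members.
\<close>

section \<open>The restriction order and down-closures in a restriction category\<close>

context restriction_category
begin

lemmas hom_simps = Id_in_Hom Comp_in_Hom Rest_in_Hom Id_Comp Comp_Id Comp_assoc Rest_Comp

lemma Rest_Id:
  assumes "A \<in> Obj X"
  shows "Rest X A A (Id X A) = Id X A"
  using Rest_Comp[of A A "Id X A"] assms by (simp add: hom_simps)

lemma Rest_Rest:
  assumes "A \<in> Obj X" "B \<in> Obj X" "f \<in> Hom X A B"
  shows "Rest X A A (Rest X A B f) = Rest X A B f"
  using Rest_Rest_Comp[of A A B "Id X A" f] assms by (simp add: hom_simps Rest_Id)

text \<open>Reading the restriction of a map as its domain, a composite is defined only where its
  first factor is. The restriction of \<open>f\<close> is absorbed by the composite, and
  \<open>Rest_Rest_Comp\<close> turns this into an equation of restrictions.\<close>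

lemma Rest_Comp_Rest:
  assumes "A \<in> Obj X" "B \<in> Obj X" "C \<in> Obj X" "f \<in> Hom X A B" "g \<in> Hom X B C"
  shows "Comp X A A A (Rest X A B f) (Rest X A C (Comp X A B C f g)) = Rest X A C (Comp X A B C f g)"
proof -
  have "Comp X A A C (Rest X A B f) (Comp X A B C f g) = Comp X A B C f g"
    using assms by (simp add: hom_simps flip: Comp_assoc)
  then show ?thesis
    using Rest_Rest_Comp[of A C B "Comp X A B C f g" f] assms by (simp add: hom_simps)
qed

lemma rest_le_refl:
  assumes "A \<in> Obj X" "B \<in> Obj X" "f \<in> Hom X A B"
  shows "rest_le X A B f f"
  using assms by (simp add: rest_le_def hom_simps)

lemma Rest_Comp_le:
  assumes "A \<in> Obj X" "B \<in> Obj X" "C \<in> Obj X" "f \<in> Hom X A B" "g \<in> Hom X A C"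
  shows "rest_le X A B (Comp X A A B (Rest X A C g) f) f"
  using assms by (simp add: rest_le_def hom_simps Rest_Rest_Comp)

text \<open>Cutting \<open>g\<close> down to the domain of \<open>f\<close> gives \<open>f\<close>;
  take restrictions on both sides.\<close>

lemma rest_le_Rest_Comp:
  assumes "A \<in> Obj X" "B \<in> Obj X" "f \<in> Hom X A B" "g \<in> Hom X A B" "rest_le X A B f g"
  shows "Comp X A A A (Rest X A B f) (Rest X A B g) = Rest X A B f"
  using Rest_Rest_Comp[of A B B g f] assms by (simp add: rest_le_def)

lemma rest_le_trans:
  assumes "A \<in> Obj X" "B \<in> Obj X" "f \<in> Hom X A B" "g \<in> Hom X A B" "h \<in> Hom X A B"
    and "rest_le X A B f g" "rest_le X A B g h"
  shows "rest_le X A B f h"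
proof -
  have "f = Comp X A A B (Rest X A B f) (Comp X A A B (Rest X A B g) h)"
    using assms(6,7) by (simp add: rest_le_def)
  also have "\<dots> = Comp X A A B (Rest X A B f) h"
    using assms rest_le_Rest_Comp[of A B f g] by (simp add: hom_simps flip: Comp_assoc)
  finally show ?thesis
    by (simp add: rest_le_def)
qed

text \<open>Restrictions commute, so the two domain inclusions force equal domains, and then cutting
  \<open>g\<close> down to the domain of \<open>f\<close> changes nothing.\<close>

lemma rest_le_antisym:
  assumes "A \<in> Obj X" "B \<in> Obj X" "f \<in> Hom X A B" "g \<in> Hom X A B"
    and "rest_le X A B f g" "rest_le X A B g f"
  shows "f = g"
proof -
  have "Rest X A B f = Rest X A B g"
    using rest_le_Rest_Comp[of A B f g] rest_le_Rest_Comp[of A B g f] Rest_commute[of A B B f g] assms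
    by simp
  moreover have "f = Comp X A A B (Rest X A B f) g"
    using assms(5) by (simp add: rest_le_def)
  ultimately show ?thesis
    using assms Rest_Comp by simp
qed

text \<open>Replace \<open>f\<close> by \<open>f'\<close> cut down by \<open>?e\<close>, and
  \<open>g\<close> by \<open>g'\<close> cut down to the domain of \<open>g\<close>. By
  \<open>Comp_Rest\<close> the second restriction moves in front of \<open>f'\<close>, where it
  becomes \<open>?d\<close>. The product of \<open>?e\<close> and \<open>?d\<close> is exactly the
  restriction of the composite of \<open>f\<close> and \<open>g\<close>.\<close>

lemma rest_le_Comp:
  assumes "A \<in> Obj X" "B \<in> Obj X" "C \<in> Obj X" "f \<in> Hom X A B" "f' \<in> Hom X A B"
    "g \<in> Hom X B C" "g' \<in> Hom X B C"
    and "rest_le X A B f f'" "rest_le X B C g g'"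
  shows "rest_le X A C (Comp X A B C f g) (Comp X A B C f' g')"
proof -
  let ?e = "Rest X A B f" and ?d = "Rest X A C (Comp X A B C f' g)"
  have fg: "Comp X A B C f g = Comp X A A C ?e (Comp X A B C f' g)"
    using assms by (simp add: rest_le_def hom_simps flip: Comp_assoc)
  have rest: "Rest X A C (Comp X A B C f g) = Comp X A A A ?e ?d"
    unfolding fg using assms by (simp add: Rest_Rest_Comp hom_simps)
  have "Comp X A B C f' g = Comp X A B C (Comp X A B B f' (Rest X B C g)) g'"
    using assms by (simp add: rest_le_def hom_simps)
  also have "\<dots> = Comp X A A C ?d (Comp X A B C f' g')"
    using assms by (simp add: Comp_Rest[of A B C] hom_simps)
  finally have "Comp X A B C f g = Comp X A A C ?e (Comp X A A C ?d (Comp X A B C f' g'))"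
    using fg by simp
  then show ?thesis
    unfolding rest_le_def rest using assms by (simp add: hom_simps)
qed

lemma rest_le_Rest:
  assumes "A \<in> Obj X" "B \<in> Obj X" "f \<in> Hom X A B" "g \<in> Hom X A B" "rest_le X A B f g"
  shows "rest_le X A A (Rest X A B f) (Rest X A B g)"
  using assms by (simp add: rest_le_def[of X A A] Rest_Rest rest_le_Rest_Comp)

text \<open>This supplies preimages under \<open>Rest\<close>: anything below the domain of
  \<open>f\<close> is itself the domain of a map below \<open>f\<close>.\<close>

lemma Rest_of_le:
  assumes "A \<in> Obj X" "B \<in> Obj X" "e \<in> Hom X A A" "f \<in> Hom X A B"
    and "rest_le X A A e (Rest X A B f)"
  shows "Rest X A B (Comp X A A B (Rest X A A e) f) = e"
  using assms by (simp add: rest_le_def Rest_Rest_Comp)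

text \<open>Lying below the identity means being equal to one's own restriction. The identities of
  \<open>DJ X\<close> thus become down-sets with one generator, to which the facts on
  \<open>down\<close> apply.\<close>

lemma rest_idems_eq_down_Id:
  assumes "A \<in> Obj X"
  shows "rest_idems X A = down X A A {Id X A}"
  using assms by (auto simp: rest_idems_def down_def rest_le_def hom_simps)

lemma down_closed:
  assumes "A \<in> Obj X" "B \<in> Obj X" "F \<subseteq> Hom X A B" "g \<in> down X A B F" "f \<in> Hom X A B"
    and "rest_le X A B f g"
  shows "f \<in> down X A B F"
  using assms rest_le_trans[of A B f g] unfolding down_def by blast

lemma subset_down:
  assumes "A \<in> Obj X" "B \<in> Obj X" "F \<subseteq> Hom X A B"
  shows "F \<subseteq> down X A B F"
  using assms rest_le_refl unfolding down_def by blast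

text \<open>Composition of down-closures can be computed on generators. One inclusion is
  monotonicity of composition; the other factors each map below a product.\<close>

lemma down_Comp:
  assumes "A \<in> Obj X" "B \<in> Obj X" "C \<in> Obj X" "F \<subseteq> Hom X A B" "G \<subseteq> Hom X B C"
  shows "{Comp X A B C f g |f g. f \<in> down X A B F \<and> g \<in> down X B C G} =
    down X A C {Comp X A B C f g |f g. f \<in> F \<and> g \<in> G}" (is "?L = ?R")
proof
  show "?L \<subseteq> ?R"
  proof
    fix x
    assume "x \<in> ?L"
    then obtain f g f' g' where fg: "x = Comp X A B C f g" "f \<in> Hom X A B" "g \<in> Hom X B C"
        "f' \<in> F" "g' \<in> G" "rest_le X A B f f'" "rest_le X B C g g'"
      unfolding down_def by blast
    then have "rest_le X A C x (Comp X A B C f' g')"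
      using assms rest_le_Comp[of A B C f f' g g'] by blast
    then show "x \<in> ?R"
      using assms fg Comp_in_Hom[of A B C f g] unfolding down_def by blast
  qed
  show "?R \<subseteq> ?L"
  proof
    fix x
    assume "x \<in> ?R"
    then obtain f g where fg: "x \<in> Hom X A C" "f \<in> F" "g \<in> G"
        "rest_le X A C x (Comp X A B C f g)"
      unfolding down_def by blast
    then have fg': "f \<in> Hom X A B" "g \<in> Hom X B C"
      using assms by auto
    \<comment> \<open>It is enough to cut down the first factor to the domain of \<open>x\<close>;
      \<open>g\<close> stays whole.\<close>
    have "x = Comp X A B C (Comp X A A B (Rest X A C x) f) g"
      using assms fg fg' by (simp add: hom_simps rest_le_def)
    moreover have "Comp X A A B (Rest X A C x) f \<in> down X A B F"
      using assms fg fg' Rest_Comp_le[of A B C f x] by (auto simp: down_def hom_simps)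
    moreover have "g \<in> down X B C G"
      using assms fg subset_down[of B C G] by blast
    ultimately show "x \<in> ?L"
      by blast
  qed
qed

lemma down_Rest:
  assumes "A \<in> Obj X" "B \<in> Obj X" "F \<subseteq> Hom X A B"
  shows "Rest X A B ` down X A B F = down X A A (Rest X A B ` F)"
proof
  show "Rest X A B ` down X A B F \<subseteq> down X A A (Rest X A B ` F)"
    using assms rest_le_Rest[of A B] Rest_in_Hom[of A B] unfolding down_def by blast
  show "down X A A (Rest X A B ` F) \<subseteq> Rest X A B ` down X A B F"
  proof
    fix e
    assume "e \<in> down X A A (Rest X A B ` F)"
    then obtain f where e: "e \<in> Hom X A A" "f \<in> F" "rest_le X A A e (Rest X A B f)"
      unfolding down_def by blast
    then have "f \<in> Hom X A B"
      using assms by auto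
    \<comment> \<open>The preimage of \<open>e\<close> is the generator \<open>f\<close> cut down to
      \<open>e\<close>.\<close>
    then have "Comp X A A B (Rest X A A e) f \<in> down X A B F"
      and "e = Rest X A B (Comp X A A B (Rest X A A e) f)"
      using assms e Rest_Comp_le[of A B A f e] Rest_of_le[of A B e f]
      by (auto simp: down_def hom_simps)
    then show "e \<in> Rest X A B ` down X A B F"
      by blast
  qed
qed

end

section \<open>Zeroes and disjointness\<close>

context perp_restriction_category
begin

lemma rest_le_Zero:
  assumes "A \<in> Obj X" "B \<in> Obj X" "f \<in> Hom X A B"
  shows "rest_le X A B (Zero X A B) f"
  using assms by (simp add: rest_le_def Rest_Zero Zero_Comp)

lemma down_Zero:
  assumes "A \<in> Obj X" "B \<in> Obj X"
  shows "down X A B {Zero X A B} = {Zero X A B}"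
  using assms by (auto simp: down_def rest_le_def Comp_Zero Zero_in_Hom Rest_in_Hom)

text \<open>The axiom makes zero disjoint from the identity only; composing the identity with
  \<open>f\<close> on the right extends this to every \<open>f\<close>.\<close>

lemma Zero_perp:
  assumes "A \<in> Obj X" "B \<in> Obj X" "C \<in> Obj X" "f \<in> Hom X A C"
  shows "Perp X A B C (Zero X A B) f"
proof -
  have "Perp X A C B f (Zero X A B)"
    using perp_Comp[of A A A B C B "Id X A" "Id X A" "Zero X A B" f "Id X B"] assms
    by (simp add: Id_perp_Zero Zero_in_Hom hom_simps)
  then show ?thesis
    using assms perp_sym[of A C B] by (simp add: Zero_in_Hom)
qed

lemma perp_Comp_left:
  assumes "D \<in> Obj X" "A \<in> Obj X" "B \<in> Obj X" "C \<in> Obj X"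
    "h \<in> Hom X D A" "f \<in> Hom X A B" "g \<in> Hom X A C" "Perp X A B C f g"
  shows "Perp X D B C (Comp X D A B h f) (Comp X D A C h g)"
  using perp_Comp[of D A B C B C h f g "Id X B" "Id X C"] assms by (simp add: hom_simps)

lemma perp_Comp_right:
  assumes "A \<in> Obj X" "B \<in> Obj X" "C \<in> Obj X" "B' \<in> Obj X" "C' \<in> Obj X"
    "f \<in> Hom X A B" "g \<in> Hom X A C" "k \<in> Hom X B B'" "k' \<in> Hom X C C'" "Perp X A B C f g"
  shows "Perp X A B' C' (Comp X A B B' f k) (Comp X A C C' g k')"
  using perp_Comp[of A A B C B' C' "Id X A" f g k k'] assms by (simp add: hom_simps)

text \<open>Disjoint maps have disjoint domains. The product \<open>?e\<close> of the restrictions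
  lies below both, so it is disjoint from itself and hence zero.\<close>

lemma perp_imp_Rest_Comp_Zero:
  assumes "A \<in> Obj X" "B \<in> Obj X" "C \<in> Obj X" "f \<in> Hom X A B" "g \<in> Hom X A C"
    and "Perp X A B C f g"
  shows "Comp X A A C (Rest X A B f) g = Zero X A C"
proof -
  let ?f = "Rest X A B f" and ?g = "Rest X A C g"
  let ?e = "Comp X A A A ?f ?g"
  have "Perp X A A A ?f ?g"
    using assms perp_Rest by blast
  moreover have "rest_le X A A ?e ?g"
    using assms Rest_Comp_le[of A A B ?g f] by (simp add: hom_simps)
  moreover have "rest_le X A A ?e ?f"
    using assms Rest_Comp_le[of A A C ?f g] Rest_commute[of A B C f g] by (simp add: hom_simps)
  ultimately have "Perp X A A A ?e ?e"
    using assms perp_down[of A A A ?e ?f ?e ?g] by (simp add: hom_simps)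
  then have "?e = Zero X A A"
    using assms by (intro perp_self) (simp_all add: hom_simps)
  then have "Comp X A A C ?e g = Zero X A C"
    using assms by (simp add: Zero_Comp)
  then show ?thesis
    using assms by (simp add: hom_simps)
qed

section \<open>The maps of \<open>DJ X\<close> and their order\<close>

lemma Obj_DJ: "Obj (DJ X) = Obj X"
  and Id_DJ: "Id (DJ X) A = rest_idems X A"
  and Comp_DJ: "Comp (DJ X) A B C S T = {Comp X A B C f g |f g. f \<in> S \<and> g \<in> T}"
  and Rest_DJ: "Rest (DJ X) A B S = Rest X A B ` S"
  and Zero_DJ: "Zero (DJ X) A B = {Zero X A B}"
  and Perp_DJ: "Perp (DJ X) A B C S T \<longleftrightarrow> (\<forall>f\<in>S. \<forall>g\<in>T. Perp X A B C f g)"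
  by (auto simp: DJ_def)

lemmas DJ_simps = Obj_DJ Id_DJ Comp_DJ Rest_DJ Zero_DJ Perp_DJ

lemma Hom_DJ_I:
  assumes "F \<subseteq> Hom X A B" "F \<noteq> {}" "pairwise (Perp X A B B) F"
  shows "down X A B F \<in> Hom (DJ X) A B"
  using assms unfolding DJ_def by auto

lemma Hom_DJ_E:
  assumes "S \<in> Hom (DJ X) A B"
  obtains F where "S = down X A B F" "F \<subseteq> Hom X A B" "F \<noteq> {}" "pairwise (Perp X A B B) F"
  using assms unfolding DJ_def by auto

lemma Hom_DJ_Hom:
  assumes "S \<in> Hom (DJ X) A B" "f \<in> S"
  shows "f \<in> Hom X A B"
  using assms by (auto simp: down_def elim: Hom_DJ_E)

lemma Hom_DJ_down:
  assumes "A \<in> Obj X" "B \<in> Obj X" "S \<in> Hom (DJ X) A B" "g \<in> S" "f \<in> Hom X A B" "rest_le X A B f g"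
  shows "f \<in> S"
  using assms(3) by (rule Hom_DJ_E) (use assms down_closed in blast)

lemma Rest_Comp_mem_Hom_DJ:
  assumes "A \<in> Obj X" "B \<in> Obj X" "C \<in> Obj X" "S \<in> Hom (DJ X) A B" "f \<in> S" "g \<in> Hom X A C"
  shows "Comp X A A B (Rest X A C g) f \<in> S"
proof (rule Hom_DJ_down)
  have "f \<in> Hom X A B"
    using assms Hom_DJ_Hom by blast
  then show "Comp X A A B (Rest X A C g) f \<in> Hom X A B"
    "rest_le X A B (Comp X A A B (Rest X A C g) f) f"
    using assms Rest_Comp_le by (simp_all add: hom_simps)
qed (use assms in simp_all)

lemma Hom_DJ_nonempty:
  assumes "A \<in> Obj X" "B \<in> Obj X" "S \<in> Hom (DJ X) A B"
  obtains f where "f \<in> S"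
  using assms(3) by (rule Hom_DJ_E) (use assms subset_down in blast)

lemma Zero_mem_Hom_DJ:
  assumes "A \<in> Obj X" "B \<in> Obj X" "S \<in> Hom (DJ X) A B"
  shows "Zero X A B \<in> S"
proof -
  obtain f where "f \<in> S"
    using assms by (rule Hom_DJ_nonempty)
  then show ?thesis
    using assms Hom_DJ_Hom Hom_DJ_down[of A B S f] by (simp add: rest_le_Zero Zero_in_Hom)
qed

text \<open>Compare generators above \<open>f\<close> and \<open>g\<close>. If they coincide they
  are a common bound; otherwise they are disjoint, and disjointness passes down. Later arguments
  about two members can thus avoid choosing generators.\<close>

lemma Hom_DJ_bounded_or_perp:
  assumes "A \<in> Obj X" "B \<in> Obj X" "S \<in> Hom (DJ X) A B" "f \<in> S" "g \<in> S"
  shows "(\<exists>h\<in>S. rest_le X A B f h \<and> rest_le X A B g h) \<or> Perp X A B B f g"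
proof -
  obtain F where F: "S = down X A B F" "F \<subseteq> Hom X A B" "pairwise (Perp X A B B) F"
    using assms(3) by (rule Hom_DJ_E)
  obtain f' g' where fg: "f' \<in> F" "g' \<in> F" "rest_le X A B f f'" "rest_le X A B g g'"
    using assms F unfolding down_def by blast
  show ?thesis
  proof (cases "f' = g'")
    case True
    then show ?thesis
      using fg F assms subset_down[of A B F] by blast
  next
    case False
    then have "Perp X A B B f' g'"
      using F fg by (auto simp: pairwise_def)
    moreover have "f' \<in> Hom X A B" "g' \<in> Hom X A B" "f \<in> Hom X A B" "g \<in> Hom X A B"
      using fg F assms by (auto simp: down_def)
    ultimately show ?thesis
      using perp_down[of A B B f f' g g'] assms fg by blast
  qed
qed

text \<open>With a common bound \<open>h\<close>, both sides are \<open>h\<close> cut down to both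
  domains; for disjoint members both sides are zero.\<close>

lemma Hom_DJ_compatible:
  assumes "A \<in> Obj X" "B \<in> Obj X" "S \<in> Hom (DJ X) A B" "f \<in> S" "g \<in> S"
  shows "Comp X A A B (Rest X A B f) g = Comp X A A B (Rest X A B g) f"
proof -
  have fg: "f \<in> Hom X A B" "g \<in> Hom X A B"
    using assms Hom_DJ_Hom by auto
  from Hom_DJ_bounded_or_perp[OF assms] show ?thesis
  proof
    assume "\<exists>h\<in>S. rest_le X A B f h \<and> rest_le X A B g h"
    then obtain h where h: "h \<in> S" "rest_le X A B f h" "rest_le X A B g h"
      by blast
    then have hh: "h \<in> Hom X A B"
      using assms Hom_DJ_Hom by auto
    have "Comp X A A B (Rest X A B f) g
        = Comp X A A B (Rest X A B f) (Comp X A A B (Rest X A B g) h)"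
      using h by (simp add: rest_le_def)
    also have "\<dots> = Comp X A A B (Rest X A B g) (Comp X A A B (Rest X A B f) h)"
      using fg hh assms Rest_commute[of A B B f g] by (simp add: hom_simps flip: Comp_assoc)
    finally show ?thesis
      using h by (simp add: rest_le_def)
  next
    assume "Perp X A B B f g"
    then show ?thesis
      using fg assms perp_imp_Rest_Comp_Zero[of A B B] perp_sym[of A B B f g] by simp
  qed
qed

text \<open>This turns every statement about order and joins in \<open>DJ X\<close> into one about
  sets. From left to right only down-closure of \<open>T\<close> is used, since each product lies
  below its factor in \<open>T\<close>.\<close>

lemma rest_le_DJ:
  assumes "A \<in> Obj X" "B \<in> Obj X" "S \<in> Hom (DJ X) A B" "T \<in> Hom (DJ X) A B"
  shows "rest_le (DJ X) A B S T \<longleftrightarrow> S \<subseteq> T"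
proof
  assume "rest_le (DJ X) A B S T"
  then have S: "S = {Comp X A A B e g |e g. e \<in> Rest X A B ` S \<and> g \<in> T}"
    by (simp add: rest_le_def DJ_simps)
  show "S \<subseteq> T"
  proof
    fix f
    assume "f \<in> S"
    then obtain f' g where f: "f' \<in> S" "g \<in> T" "f = Comp X A A B (Rest X A B f') g"
      using S by blast
    then show "f \<in> T"
      using assms Hom_DJ_Hom Rest_Comp_mem_Hom_DJ by simp
  qed
next
  assume ST: "S \<subseteq> T"
  have "{Comp X A A B e g |e g. e \<in> Rest X A B ` S \<and> g \<in> T} = S" (is "?L = S")
  proof
    show "S \<subseteq> ?L"
    proof
      fix f
      assume "f \<in> S"
      moreover from this have "f = Comp X A A B (Rest X A B f) f"
        using assms Hom_DJ_Hom by (simp add: Rest_Comp)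
      ultimately show "f \<in> ?L"
        using ST by blast
    qed
    show "?L \<subseteq> S"
    proof
      fix x
      assume "x \<in> ?L"
      then obtain f g where x: "x = Comp X A A B (Rest X A B f) g" "f \<in> S" "g \<in> T"
        by blast
      \<comment> \<open>The product visibly lies below \<open>g\<close>, which need not be in
        \<open>S\<close>. As \<open>f\<close> is in \<open>T\<close> too, compatibility inside
        \<open>T\<close> exhibits it as a map below \<open>f\<close>.\<close>
      then have "x = Comp X A A B (Rest X A B g) f"
        using ST assms Hom_DJ_compatible[of A B T f g] by auto
      moreover have "g \<in> Hom X A B"
        using x assms Hom_DJ_Hom by auto
      ultimately show "x \<in> S"
        using x(2) assms Rest_Comp_mem_Hom_DJ by simp
    qed
  qed
  then show "rest_le (DJ X) A B S T"
    by (simp add: rest_le_def DJ_simps)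
qed

section \<open>The axioms of a disjointness-equipped restriction category for
  \<open>DJ X\<close>\<close>

lemma Id_in_Hom_DJ:
  assumes "A \<in> Obj X"
  shows "rest_idems X A \<in> Hom (DJ X) A A"
  using assms Hom_DJ_I[of "{Id X A}"] by (simp add: rest_idems_eq_down_Id hom_simps)

text \<open>Products of generators serve as generators. Distinct products with different first
  factors are disjoint because those factors are; with equal first factors the second factors must
  differ and are disjoint.\<close>

lemma Comp_in_Hom_DJ:
  assumes "A \<in> Obj X" "B \<in> Obj X" "C \<in> Obj X" "S \<in> Hom (DJ X) A B" "T \<in> Hom (DJ X) B C"
  shows "Comp (DJ X) A B C S T \<in> Hom (DJ X) A C"
proof -
  obtain F where F: "S = down X A B F" "F \<subseteq> Hom X A B" "F \<noteq> {}" "pairwise (Perp X A B B) F"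
    using assms(4) by (rule Hom_DJ_E)
  obtain G where G: "T = down X B C G" "G \<subseteq> Hom X B C" "G \<noteq> {}" "pairwise (Perp X B C C) G"
    using assms(5) by (rule Hom_DJ_E)
  let ?H = "{Comp X A B C f g |f g. f \<in> F \<and> g \<in> G}"
  have "pairwise (Perp X A C C) ?H"
  proof (rule pairwiseI)
    fix x y
    assume "x \<in> ?H" "y \<in> ?H" "x \<noteq> y"
    then obtain f g f' g' where xy: "x = Comp X A B C f g" "y = Comp X A B C f' g'"
        "f \<in> F" "g \<in> G" "f' \<in> F" "g' \<in> G"
      by blast
    then have homs: "f \<in> Hom X A B" "g \<in> Hom X B C" "f' \<in> Hom X A B" "g' \<in> Hom X B C"
      using F G by auto
    show "Perp X A C C x y"
    proof (cases "f = f'")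
      case True
      then have "Perp X B C C g g'"
        using xy G \<open>x \<noteq> y\<close> by (auto simp: pairwise_def)
      then show ?thesis
        using xy True homs assms perp_Comp_left by simp
    next
      case False
      then have "Perp X A B B f f'"
        using xy F by (auto simp: pairwise_def)
      then show ?thesis
        using xy homs assms perp_Comp_right by simp
    qed
  qed
  moreover have "?H \<subseteq> Hom X A C"
    using F G assms Comp_in_Hom by blast
  moreover have "?H \<noteq> {}"
    using F G by blast
  ultimately show ?thesis
    using Hom_DJ_I[of ?H A C] F G assms by (simp add: Comp_DJ down_Comp)
qed

lemma Rest_in_Hom_DJ:
  assumes "A \<in> Obj X" "B \<in> Obj X" "S \<in> Hom (DJ X) A B"
  shows "Rest X A B ` S \<in> Hom (DJ X) A A"
proof -
  obtain F where F: "S = down X A B F" "F \<subseteq> Hom X A B" "F \<noteq> {}" "pairwise (Perp X A B B) F"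
    using assms(3) by (rule Hom_DJ_E)
  have "pairwise (Perp X A A A) (Rest X A B ` F)"
  proof (rule pairwiseI)
    fix x y
    assume "x \<in> Rest X A B ` F" "y \<in> Rest X A B ` F" "x \<noteq> y"
    then obtain f g where "x = Rest X A B f" "y = Rest X A B g" "f \<in> F" "g \<in> F" "f \<noteq> g"
      by blast
    moreover from this have "Perp X A B B f g"
      using F by (auto simp: pairwise_def)
    ultimately show "Perp X A A A x y"
      using F assms perp_Rest[of A B B f g] by auto
  qed
  moreover have "Rest X A B ` F \<subseteq> Hom X A A"
    using F assms Rest_in_Hom by blast
  ultimately show ?thesis
    using Hom_DJ_I[of "Rest X A B ` F" A A] F assms by (simp add: down_Rest)
qed

lemma Zero_in_Hom_DJ:
  assumes "A \<in> Obj X" "B \<in> Obj X"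
  shows "{Zero X A B} \<in> Hom (DJ X) A B"
  using assms Hom_DJ_I[of "{Zero X A B}" A B] by (simp add: down_Zero Zero_in_Hom)

lemma category_DJ: "category (DJ X)"
proof
  fix A
  assume "A \<in> Obj (DJ X)"
  then show "Id (DJ X) A \<in> Hom (DJ X) A A"
    by (simp add: DJ_simps Id_in_Hom_DJ)
next
  fix A B C S T
  assume "A \<in> Obj (DJ X)" "B \<in> Obj (DJ X)" "C \<in> Obj (DJ X)"
    "S \<in> Hom (DJ X) A B" "T \<in> Hom (DJ X) B C"
  then show "Comp (DJ X) A B C S T \<in> Hom (DJ X) A C"
    by (simp add: Obj_DJ Comp_in_Hom_DJ)
next
  fix A B S
  assume "A \<in> Obj (DJ X)" "B \<in> Obj (DJ X)" "S \<in> Hom (DJ X) A B"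
  moreover obtain F where "S = down X A B F" "F \<subseteq> Hom X A B"
    using \<open>S \<in> Hom (DJ X) A B\<close> by (rule Hom_DJ_E)
  \<comment> \<open>Through \<open>down_Comp\<close> the unit laws need checking only on generators,
    with the single generator \<open>Id\<close> for the identity.\<close>
  moreover from calculation have "{Comp X A A B f g |f g. f \<in> {Id X A} \<and> g \<in> F} = F"
    "{Comp X A B B f g |f g. f \<in> F \<and> g \<in> {Id X B}} = F"
    by (force simp: Obj_DJ Id_Comp Comp_Id)+
  ultimately show "Comp (DJ X) A A B (Id (DJ X) A) S = S" "Comp (DJ X) A B B S (Id (DJ X) B) = S"
    by (simp_all add: DJ_simps rest_idems_eq_down_Id down_Comp hom_simps)
next
  fix A B C D S T U
  assume obj: "A \<in> Obj (DJ X)" "B \<in> Obj (DJ X)" "C \<in> Obj (DJ X)" "D \<in> Obj (DJ X)"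
    and hom: "S \<in> Hom (DJ X) A B" "T \<in> Hom (DJ X) B C" "U \<in> Hom (DJ X) C D"
  have assoc: "Comp X A C D (Comp X A B C f g) h = Comp X A B D f (Comp X B C D g h)"
    if "f \<in> S" "g \<in> T" "h \<in> U" for f g h
    using that obj hom Hom_DJ_Hom by (simp add: Obj_DJ Comp_assoc)
  show "Comp (DJ X) A C D (Comp (DJ X) A B C S T) U = Comp (DJ X) A B D S (Comp (DJ X) B C D T U)"
    unfolding Comp_DJ
  proof (intro set_eqI iffI)
    fix x
    assume "x \<in> {Comp X A C D f g |f g. f \<in> {Comp X A B C f g |f g. f \<in> S \<and> g \<in> T} \<and> g \<in> U}"
    then show "x \<in> {Comp X A B D f g |f g. f \<in> S \<and> g \<in> {Comp X B C D f g |f g. f \<in> T \<and> g \<in> U}}"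
      using assoc by blast
  next
    fix x
    assume "x \<in> {Comp X A B D f g |f g. f \<in> S \<and> g \<in> {Comp X B C D f g |f g. f \<in> T \<and> g \<in> U}}"
    then obtain f g h where "x = Comp X A B D f (Comp X B C D g h)" "f \<in> S" "g \<in> T" "h \<in> U"
      by blast
    then show "x \<in> {Comp X A C D f g |f g. f \<in> {Comp X A B C f g |f g. f \<in> S \<and> g \<in> T} \<and> g \<in> U}"
      using assoc[of f g h, symmetric] by auto
  qed
qed

text \<open>From left to right the same \<open>f\<close> is used in both places. Conversely the
  right side mixes two members of \<open>S\<close>, and compatibility is what lets them trade
  roles.\<close>

lemma Comp_Rest_DJ:
  assumes obj: "A \<in> Obj X" "B \<in> Obj X" "C \<in> Obj X"
    and S: "S \<in> Hom (DJ X) A B" and T: "T \<in> Hom (DJ X) B C"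
  shows "Comp (DJ X) A B B S (Rest (DJ X) B C T) =
    Comp (DJ X) A A B (Rest (DJ X) A C (Comp (DJ X) A B C S T)) S" (is "?L = ?R")
proof
  show "?L \<subseteq> ?R"
  proof
    fix x
    assume "x \<in> ?L"
    then obtain f g where "x = Comp X A B B f (Rest X B C g)" "f \<in> S" "g \<in> T"
      by (auto simp: DJ_simps)
    moreover from this have "x = Comp X A A B (Rest X A C (Comp X A B C f g)) f"
      using obj S T Hom_DJ_Hom by (simp add: Comp_Rest)
    ultimately show "x \<in> ?R"
      unfolding DJ_simps by blast
  qed
  show "?R \<subseteq> ?L"
  proof
    fix x
    assume "x \<in> ?R"
    then obtain f f' g where x: "x = Comp X A A B (Rest X A C (Comp X A B C f g)) f'"
        "f \<in> S" "f' \<in> S" "g \<in> T"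
      by (auto simp: DJ_simps)
    then have hom: "f \<in> Hom X A B" "f' \<in> Hom X A B" "g \<in> Hom X B C"
      using S T Hom_DJ_Hom by auto
    let ?d = "Rest X A C (Comp X A B C f g)"
    have d: "?d \<in> Hom X A A" "Rest X A B f \<in> Hom X A A" "Rest X A B f' \<in> Hom X A A"
      using obj hom by (simp_all add: hom_simps)
    \<comment> \<open>As \<open>?d\<close> lies within the domain of \<open>f\<close>, the
      restriction of \<open>f\<close> can be inserted in front of \<open>f'\<close>. Compatibility
      then puts \<open>f\<close> last, where \<open>Comp_Rest\<close> in \<open>X\<close>
      applies.\<close>
    have "?d = Comp X A A A ?d (Rest X A B f)"
      using obj hom Rest_Comp_Rest[of A B C f g] Rest_commute[of A B C f "Comp X A B C f g"]
      by (simp add: Comp_in_Hom)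
    then have "x = Comp X A A B ?d (Comp X A A B (Rest X A B f) f')"
      using x(1) obj hom d Comp_assoc[of A A A B ?d "Rest X A B f" f'] by simp
    also have "\<dots> = Comp X A A B ?d (Comp X A A B (Rest X A B f') f)"
      using Hom_DJ_compatible[of A B S f f'] obj S x by simp
    also have "\<dots> = Comp X A A B (Rest X A B f') (Comp X A A B ?d f)"
      using obj hom d Comp_assoc[of A A A B ?d "Rest X A B f'" f]
        Comp_assoc[of A A A B "Rest X A B f'" ?d f] Rest_commute[of A B C f' "Comp X A B C f g"]
      by (simp add: Comp_in_Hom)
    also have "\<dots> = Comp X A B B (Comp X A A B (Rest X A B f') f) (Rest X B C g)"
      using obj hom by (simp add: Comp_Rest[of A B C] hom_simps)
    finally have "x = Comp X A B B (Comp X A A B (Rest X A B f') f) (Rest X B C g)" .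
    moreover have "Comp X A A B (Rest X A B f') f \<in> S"
      using obj hom S x Rest_Comp_mem_Hom_DJ by simp
    ultimately show "x \<in> ?L"
      using x by (auto simp: DJ_simps)
  qed
qed

lemma restriction_category_DJ: "restriction_category (DJ X)"
proof (intro restriction_category.intro category_DJ restriction_category_axioms.intro)
  fix A B S
  assume "A \<in> Obj (DJ X)" "B \<in> Obj (DJ X)" "S \<in> Hom (DJ X) A B"
  then show "Rest (DJ X) A B S \<in> Hom (DJ X) A A"
    by (simp add: DJ_simps Rest_in_Hom_DJ)
next
  fix A B S
  assume "A \<in> Obj (DJ X)" "B \<in> Obj (DJ X)" "S \<in> Hom (DJ X) A B"
  \<comment> \<open>Unfolded, this is reflexivity of the order of \<open>DJ X\<close>, that is, of
    inclusion.\<close>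
  then show "Comp (DJ X) A A B (Rest (DJ X) A B S) S = S"
    using rest_le_DJ[of A B S S] by (simp add: Obj_DJ rest_le_def)
next
  fix A B C S T
  assume "A \<in> Obj (DJ X)" "B \<in> Obj (DJ X)" "C \<in> Obj (DJ X)"
    "S \<in> Hom (DJ X) A B" "T \<in> Hom (DJ X) A C"
  then have "Comp X A A A (Rest X A B f) (Rest X A C g) = Comp X A A A (Rest X A C g) (Rest X A B f)"
    if "f \<in> S" "g \<in> T" for f g
    using that Hom_DJ_Hom Rest_commute by (simp add: Obj_DJ)
  then show "Comp (DJ X) A A A (Rest (DJ X) A B S) (Rest (DJ X) A C T) =
      Comp (DJ X) A A A (Rest (DJ X) A C T) (Rest (DJ X) A B S)"
    by (auto simp: DJ_simps) (metis imageI)+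
next
  fix A B C S T
  assume "A \<in> Obj (DJ X)" "B \<in> Obj (DJ X)" "C \<in> Obj (DJ X)"
    "S \<in> Hom (DJ X) A B" "T \<in> Hom (DJ X) A C"
  then have eq: "Rest X A B (Comp X A A B (Rest X A C g) f) = Comp X A A A (Rest X A C g) (Rest X A B f)"
    if "f \<in> S" "g \<in> T" for f g
    using that Hom_DJ_Hom Rest_Rest_Comp by (simp add: Obj_DJ)
  show "Rest (DJ X) A B (Comp (DJ X) A A B (Rest (DJ X) A C T) S) =
      Comp (DJ X) A A A (Rest (DJ X) A C T) (Rest (DJ X) A B S)"
  proof (intro set_eqI iffI)
    fix x
    assume "x \<in> Rest (DJ X) A B (Comp (DJ X) A A B (Rest (DJ X) A C T) S)"
    then show "x \<in> Comp (DJ X) A A A (Rest (DJ X) A C T) (Rest (DJ X) A B S)"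
      using eq by (auto simp: DJ_simps)
  next
    fix x
    assume "x \<in> Comp (DJ X) A A A (Rest (DJ X) A C T) (Rest (DJ X) A B S)"
    then obtain f g where "x = Comp X A A A (Rest X A C g) (Rest X A B f)" "f \<in> S" "g \<in> T"
      by (auto simp: DJ_simps)
    then show "x \<in> Rest (DJ X) A B (Comp (DJ X) A A B (Rest (DJ X) A C T) S)"
      using eq[of f g, symmetric] by (auto simp: DJ_simps)
  qed
next
  fix A B C S T
  assume "A \<in> Obj (DJ X)" "B \<in> Obj (DJ X)" "C \<in> Obj (DJ X)"
    "S \<in> Hom (DJ X) A B" "T \<in> Hom (DJ X) B C"
  then show "Comp (DJ X) A B B S (Rest (DJ X) B C T) =
      Comp (DJ X) A A B (Rest (DJ X) A C (Comp (DJ X) A B C S T)) S"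
    by (simp add: Obj_DJ Comp_Rest_DJ)
qed

lemma restriction_category_with_zeroes_DJ: "restriction_category_with_zeroes (DJ X)"
proof (intro restriction_category_with_zeroes.intro restriction_category_DJ
    restriction_category_with_zeroes_axioms.intro)
  fix A B
  assume "A \<in> Obj (DJ X)" "B \<in> Obj (DJ X)"
  then show "Zero (DJ X) A B \<in> Hom (DJ X) A B"
    by (simp add: DJ_simps Zero_in_Hom_DJ)
next
  fix A B C S
  assume obj: "A \<in> Obj (DJ X)" "B \<in> Obj (DJ X)" "C \<in> Obj (DJ X)" and S: "S \<in> Hom (DJ X) A B"
  \<comment> \<open>A member of \<open>S\<close> is needed for the composite to be the zero
    singleton and not the empty set.\<close>
  then obtain f where "f \<in> S"
    using Hom_DJ_nonempty unfolding Obj_DJ by blast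
  moreover have "Comp X A B C f (Zero X B C) = Zero X A C" if "f \<in> S" for f
    using that obj S Hom_DJ_Hom Comp_Zero by (simp add: Obj_DJ)
  ultimately show "Comp (DJ X) A B C S (Zero (DJ X) B C) = Zero (DJ X) A C"
    by (auto simp: DJ_simps) metis
next
  fix A B C S
  assume obj: "A \<in> Obj (DJ X)" "B \<in> Obj (DJ X)" "C \<in> Obj (DJ X)" and S: "S \<in> Hom (DJ X) B C"
  then obtain f where "f \<in> S"
    using Hom_DJ_nonempty unfolding Obj_DJ by blast
  moreover have "Comp X A B C (Zero X A B) f = Zero X A C" if "f \<in> S" for f
    using that obj S Hom_DJ_Hom Zero_Comp by (simp add: Obj_DJ)
  ultimately show "Comp (DJ X) A B C (Zero (DJ X) A B) S = Zero (DJ X) A C"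
    by (auto simp: DJ_simps) metis
next
  fix A B
  assume "A \<in> Obj (DJ X)" "B \<in> Obj (DJ X)"
  then show "Rest (DJ X) A B (Zero (DJ X) A B) = Zero (DJ X) A A"
    by (simp add: DJ_simps Rest_Zero)
qed

text \<open>The axiom \<open>perp_Comp\<close> in \<open>X\<close> has one left factor, whereas
  composites in \<open>DJ X\<close> bring two members of \<open>H\<close>. Under a common bound
  \<open>k\<close> both composites lie below those with \<open>k\<close>, which are disjoint; if
  \<open>h\<close> and \<open>h'\<close> are disjoint, so are the composites, whatever
  follows.\<close>

lemma perp_Comp_Hom_DJ:
  assumes obj: "D \<in> Obj X" "A \<in> Obj X" "B \<in> Obj X" "C \<in> Obj X"
    and H: "H \<in> Hom (DJ X) D A" "h \<in> H" "h' \<in> H"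
    and fg: "f \<in> Hom X A B" "g \<in> Hom X A C" "Perp X A B C f g"
  shows "Perp X D B C (Comp X D A B h f) (Comp X D A C h' g)"
proof -
  have hom: "h \<in> Hom X D A" "h' \<in> Hom X D A"
    using H Hom_DJ_Hom by auto
  from Hom_DJ_bounded_or_perp[OF obj(1,2) H] show ?thesis
  proof
    assume "\<exists>k\<in>H. rest_le X D A h k \<and> rest_le X D A h' k"
    then obtain k where k: "k \<in> Hom X D A" "rest_le X D A h k" "rest_le X D A h' k"
      using H Hom_DJ_Hom by blast
    have "Perp X D B C (Comp X D A B k f) (Comp X D A C k g)"
      using obj fg k perp_Comp_left by simp
    then show ?thesis
      using obj fg hom k rest_le_Comp[of D A B h k f f] rest_le_Comp[of D A C h' k g g]
        perp_down[of D B C "Comp X D A B h f" "Comp X D A B k f" "Comp X D A C h' g" "Comp X D A C k g"]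
      by (simp add: Comp_in_Hom rest_le_refl)
  next
    assume "Perp X D A A h h'"
    then show ?thesis
      using obj fg hom perp_Comp_right by simp
  qed
qed

lemma perp_restriction_category_DJ: "perp_restriction_category (DJ X)"
proof (intro perp_restriction_category.intro restriction_category_with_zeroes_DJ
    perp_restriction_category_axioms.intro)
  fix A B
  assume "A \<in> Obj (DJ X)" "B \<in> Obj (DJ X)"
  then show "Perp (DJ X) A A B (Id (DJ X) A) (Zero (DJ X) A B)"
    using Zero_perp[of A B A] perp_sym[of A B A] by (auto simp: DJ_simps rest_idems_def Zero_in_Hom)
next
  fix A B C S T
  assume "A \<in> Obj (DJ X)" "B \<in> Obj (DJ X)" "C \<in> Obj (DJ X)"
    "S \<in> Hom (DJ X) A B" "T \<in> Hom (DJ X) A C" "Perp (DJ X) A B C S T"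
  then show "Perp (DJ X) A C B T S"
    using perp_sym[of A B C] Hom_DJ_Hom by (auto simp: DJ_simps)
next
  fix A B S
  assume "A \<in> Obj (DJ X)" "B \<in> Obj (DJ X)" "S \<in> Hom (DJ X) A B" "Perp (DJ X) A B B S S"
  \<comment> \<open>Each member is disjoint from itself, hence zero, and zero is always a
    member.\<close>
  then show "S = Zero (DJ X) A B"
    using perp_self[of A B] Hom_DJ_Hom[of S A B] Zero_mem_Hom_DJ[of A B S] by (auto simp: DJ_simps)
next
  fix A B C S S' T T'
  assume "A \<in> Obj (DJ X)" "B \<in> Obj (DJ X)" "C \<in> Obj (DJ X)"
    "S \<in> Hom (DJ X) A B" "S' \<in> Hom (DJ X) A B" "T \<in> Hom (DJ X) A C" "T' \<in> Hom (DJ X) A C"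
    "Perp (DJ X) A B C S' T'" "rest_le (DJ X) A B S S'" "rest_le (DJ X) A C T T'"
  then show "Perp (DJ X) A B C S T"
    using rest_le_DJ by (simp add: Obj_DJ Perp_DJ) blast
next
  fix D A B C B' C' H S T K K'
  assume obj: "D \<in> Obj (DJ X)" "A \<in> Obj (DJ X)" "B \<in> Obj (DJ X)" "C \<in> Obj (DJ X)"
      "B' \<in> Obj (DJ X)" "C' \<in> Obj (DJ X)"
    and hom: "H \<in> Hom (DJ X) D A" "S \<in> Hom (DJ X) A B" "T \<in> Hom (DJ X) A C"
      "K \<in> Hom (DJ X) B B'" "K' \<in> Hom (DJ X) C C'" and perp: "Perp (DJ X) A B C S T"
  have "Perp X D B' C' (Comp X D A B' h (Comp X A B B' f k)) (Comp X D A C' h' (Comp X A C C' g k'))"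
    if "h \<in> H" "h' \<in> H" "f \<in> S" "g \<in> T" "k \<in> K" "k' \<in> K'" for h h' f g k k'
  proof (rule perp_Comp_Hom_DJ)
    show "Perp X A B' C' (Comp X A B B' f k) (Comp X A C C' g k')"
      using that obj hom perp Hom_DJ_Hom perp_Comp_right by (simp add: DJ_simps)
  qed (use that obj hom Hom_DJ_Hom Comp_in_Hom in \<open>simp_all add: Obj_DJ\<close>)
  then show "Perp (DJ X) D B' C' (Comp (DJ X) D A B' H (Comp (DJ X) A B B' S K))
      (Comp (DJ X) D A C' H (Comp (DJ X) A C C' T K'))"
    by (auto simp: DJ_simps)
next
  fix A B C S T
  assume "A \<in> Obj (DJ X)" "B \<in> Obj (DJ X)" "C \<in> Obj (DJ X)"
    "S \<in> Hom (DJ X) A B" "T \<in> Hom (DJ X) A C" "Perp (DJ X) A B C S T"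
  then show "Perp (DJ X) A A A (Rest (DJ X) A B S) (Rest (DJ X) A C T)"
    using perp_Rest[of A B C] Hom_DJ_Hom by (auto simp: DJ_simps)
qed

section \<open>Joins in \<open>DJ X\<close>\<close>

lemma DJ_join_in_Hom:
  assumes "A \<in> Obj X" "B \<in> Obj X" "perp_family (DJ X) A B I S"
  shows "DJ_join X A B I S \<in> Hom (DJ X) A B"
proof (cases "I = {}")
  case True
  then show ?thesis
    using assms by (simp add: DJ_join_def Zero_in_Hom_DJ)
next
  case False
  have "\<forall>i\<in>I. \<exists>F. S i = down X A B F \<and> F \<subseteq> Hom X A B \<and> F \<noteq> {} \<and> pairwise (Perp X A B B) F"
  proof
    fix i
    assume "i \<in> I"
    then have "S i \<in> Hom (DJ X) A B"
      using assms(3) by (simp add: perp_family_def)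
    then show "\<exists>F. S i = down X A B F \<and> F \<subseteq> Hom X A B \<and> F \<noteq> {} \<and> pairwise (Perp X A B B) F"
      by (rule Hom_DJ_E) blast
  qed
  \<comment> \<open>The pooled generators generate the union. Two of them are disjoint by choice of
    \<open>F i\<close> if they share an index, and by disjointness of the family otherwise.\<close>
  then obtain F where F: "\<And>i. i \<in> I \<Longrightarrow>
      S i = down X A B (F i) \<and> F i \<subseteq> Hom X A B \<and> F i \<noteq> {} \<and> pairwise (Perp X A B B) (F i)"
    by metis
  have "pairwise (Perp X A B B) (\<Union>i\<in>I. F i)"
  proof (rule pairwiseI)
    fix f g
    assume "f \<in> (\<Union>i\<in>I. F i)" "g \<in> (\<Union>i\<in>I. F i)" "f \<noteq> g"
    then obtain i j where ij: "i \<in> I" "j \<in> I" "f \<in> F i" "g \<in> F j"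
      by blast
    show "Perp X A B B f g"
    proof (cases "i = j")
      case True
      then show ?thesis
        using F[of i] ij \<open>f \<noteq> g\<close> by (auto simp: pairwise_def)
    next
      case False
      then have "Perp (DJ X) A B B (S i) (S j)"
        using assms(3) ij by (simp add: perp_family_def)
      moreover have "f \<in> S i" "g \<in> S j"
        using F ij subset_down[of A B] assms by blast+
      ultimately show ?thesis
        by (simp add: Perp_DJ)
    qed
  qed
  moreover have "(\<Union>i\<in>I. F i) \<subseteq> Hom X A B" "(\<Union>i\<in>I. F i) \<noteq> {}"
    using F False by (simp_all add: UN_subset_iff)
  moreover have "(\<Union>i\<in>I. S i) = down X A B (\<Union>i\<in>I. F i)"
    using F by (simp add: down_def) blast
  ultimately show ?thesis
    using Hom_DJ_I[of "\<Union>i\<in>I. F i" A B] False by (simp add: DJ_join_def)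
qed

text \<open>For an empty family the join is the zero singleton, which is the least map because every
  map of \<open>DJ X\<close> contains zero.\<close>

lemma DJ_join_subset_iff:
  assumes "A \<in> Obj X" "B \<in> Obj X" "T \<in> Hom (DJ X) A B"
  shows "DJ_join X A B I S \<subseteq> T \<longleftrightarrow> (\<forall>i\<in>I. S i \<subseteq> T)"
  using assms Zero_mem_Hom_DJ[of A B T] by (auto simp: DJ_join_def)

lemma is_perp_join_DJ_join:
  assumes "A \<in> Obj X" "B \<in> Obj X" "perp_family (DJ X) A B I S"
  shows "is_perp_join (DJ X) A B I S (DJ_join X A B I S)"
proof -
  have join: "DJ_join X A B I S \<in> Hom (DJ X) A B"
    using assms by (rule DJ_join_in_Hom)
  \<comment> \<open>Taking the join itself for \<open>T\<close> shows that it is an upper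
    bound.\<close>
  moreover have "\<forall>i\<in>I. S i \<subseteq> DJ_join X A B I S"
    using DJ_join_subset_iff[OF assms(1,2) join, of I S] by simp
  moreover have "\<forall>i\<in>I. S i \<in> Hom (DJ X) A B"
    using assms(3) by (simp add: perp_family_def)
  ultimately show ?thesis
    using assms by (simp add: is_perp_join_def rest_le_DJ DJ_join_subset_iff)
qed

text \<open>Two least upper bounds include each other. Claims about arbitrary joins thereby reduce
  to \<open>DJ_join\<close>.\<close>

lemma is_perp_join_DJ_eq:
  assumes "A \<in> Obj X" "B \<in> Obj X" "is_perp_join (DJ X) A B I S T"
  shows "T = DJ_join X A B I S"
proof -
  have "is_perp_join (DJ X) A B I S (DJ_join X A B I S)"
    by (rule is_perp_join_DJ_join) (use assms in \<open>simp_all add: is_perp_join_def\<close>)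
  then have "T \<in> Hom (DJ X) A B" "DJ_join X A B I S \<in> Hom (DJ X) A B"
    "rest_le (DJ X) A B T (DJ_join X A B I S)" "rest_le (DJ X) A B (DJ_join X A B I S) T"
    using assms(3) unfolding is_perp_join_def by blast+
  then show ?thesis
    using assms rest_le_DJ by blast
qed

text \<open>Composition is formed elementwise, so it distributes over unions; the empty family is
  the law \<open>Comp_Zero\<close> of \<open>DJ X\<close>.\<close>

lemma Comp_DJ_join:
  assumes obj: "D \<in> Obj X" "A \<in> Obj X" "B \<in> Obj X" and H: "H \<in> Hom (DJ X) D A"
  shows "Comp (DJ X) D A B H (DJ_join X A B I S) = DJ_join X D B I (\<lambda>i. Comp (DJ X) D A B H (S i))"
proof (cases "I = {}")
  case True
  then show ?thesis
    using restriction_category_with_zeroes.Comp_Zero[OF restriction_category_with_zeroes_DJ, of D A B H]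
      obj H by (simp add: DJ_join_def Obj_DJ Zero_DJ)
next
  case False
  then show ?thesis
    by (auto simp: DJ_join_def Comp_DJ)
qed

lemma perp_family_DJ_Comp:
  assumes obj: "D \<in> Obj X" "A \<in> Obj X" "B \<in> Obj X" and H: "H \<in> Hom (DJ X) D A"
    and S: "perp_family (DJ X) A B I S"
  shows "perp_family (DJ X) D B I (\<lambda>i. Comp (DJ X) D A B H (S i))"
proof -
  interpret DJ: perp_restriction_category "DJ X"
    by (rule perp_restriction_category_DJ)
  show ?thesis
    using assms DJ.perp_Comp_left[of D A B B H] DJ.Comp_in_Hom[of D A B H]
    by (simp add: perp_family_def Obj_DJ)
qed

text \<open>Disjointness from a union is tested member by member; for the empty family it is
  \<open>Zero_perp\<close>.\<close>

lemma strong_perp_join_DJ_join: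
  assumes "A \<in> Obj X" "B \<in> Obj X" "perp_family (DJ X) A B I S"
  shows "strong_perp_join (DJ X) A B I S (DJ_join X A B I S)"
  unfolding strong_perp_join_def
proof (intro conjI ballI impI)
  fix C H
  assume "C \<in> Obj (DJ X)" "H \<in> Hom (DJ X) A C" "\<forall>i\<in>I. Perp (DJ X) A B C (S i) H"
  then show "Perp (DJ X) A B C (DJ_join X A B I S) H"
    using assms Hom_DJ_Hom Zero_perp[of A B C] by (auto simp: DJ_join_def DJ_simps)
qed (rule is_perp_join_DJ_join[OF assms])

lemma disjoint_perp_restriction_category_DJ:
  "disjoint_perp_restriction_category TYPE('i) (DJ X)"
  unfolding disjoint_perp_restriction_category_def
proof (intro conjI ballI allI impI perp_restriction_category_DJ)
  fix A B and I :: "'i set" and S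
  assume "A \<in> Obj (DJ X)" "B \<in> Obj (DJ X)" "perp_family (DJ X) A B I S"
  then show "\<exists>T. is_perp_join (DJ X) A B I S T"
    unfolding Obj_DJ by (intro exI[of _ "DJ_join X A B I S"] is_perp_join_DJ_join)
next
  fix D A B and I :: "'i set" and S T H
  assume obj: "D \<in> Obj (DJ X)" "A \<in> Obj (DJ X)" "B \<in> Obj (DJ X)" and H: "H \<in> Hom (DJ X) D A"
    and T: "is_perp_join (DJ X) A B I S T"
  have S: "perp_family (DJ X) A B I S"
    using T by (simp add: is_perp_join_def)
  have "T = DJ_join X A B I S"
    using obj T unfolding Obj_DJ by (intro is_perp_join_DJ_eq)
  then show "is_perp_join (DJ X) D B I (\<lambda>i. Comp (DJ X) D A B H (S i)) (Comp (DJ X) D A B H T)"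
    using obj H S by (simp add: Obj_DJ Comp_DJ_join is_perp_join_DJ_join perp_family_DJ_Comp)
next
  fix A B and I :: "'i set" and S T
  assume obj: "A \<in> Obj (DJ X)" "B \<in> Obj (DJ X)" and T: "is_perp_join (DJ X) A B I S T"
  have S: "perp_family (DJ X) A B I S"
    using T by (simp add: is_perp_join_def)
  have "T = DJ_join X A B I S"
    using obj T unfolding Obj_DJ by (intro is_perp_join_DJ_eq)
  then show "strong_perp_join (DJ X) A B I S T"
    using obj S by (simp add: Obj_DJ strong_perp_join_DJ_join)
qed

section \<open>The inclusion functor\<close>

lemma perp_restriction_functor_DJ_incl: "perp_restriction_functor X (DJ X) (\<lambda>A. A) (DJ_incl X)"
proof -
  interpret DJ: perp_restriction_category "DJ X"
    by (rule perp_restriction_category_DJ)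
  show ?thesis
  \<comment> \<open>On single generators, \<open>down_Comp\<close>, \<open>down_Rest\<close>,
    \<open>rest_idems_eq_down_Id\<close> and \<open>down_Zero\<close> become the preservation
    laws.\<close>
  proof
    fix A B f
    assume "A \<in> Obj X" "B \<in> Obj X" "f \<in> Hom X A B"
    then show "DJ_incl X A B f \<in> Hom (DJ X) A B"
      and "DJ_incl X A A (Rest X A B f) = Rest (DJ X) A B (DJ_incl X A B f)"
      using Hom_DJ_I[of "{f}" A B] by (simp_all add: DJ_incl_def Rest_DJ down_Rest)
  next
    fix A B C f g
    assume "A \<in> Obj X" "B \<in> Obj X" "C \<in> Obj X" "f \<in> Hom X A B" "g \<in> Hom X B C"
    then show "DJ_incl X A C (Comp X A B C f g) = Comp (DJ X) A B C (DJ_incl X A B f) (DJ_incl X B C g)"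
      by (simp add: DJ_incl_def Comp_DJ down_Comp)
  next
    fix A B C f g
    assume "A \<in> Obj X" "B \<in> Obj X" "C \<in> Obj X" "f \<in> Hom X A B" "g \<in> Hom X A C" "Perp X A B C f g"
    then show "Perp (DJ X) A B C (DJ_incl X A B f) (DJ_incl X A C g)"
      using perp_down[of A B C _ f _ g] by (auto simp: DJ_incl_def Perp_DJ down_def)
  qed (simp_all add: DJ_simps DJ_incl_def rest_idems_eq_down_Id down_Zero)
qed

text \<open>Each of two equal principal down-sets contains the generator of the other, so
  antisymmetry applies.\<close>

lemma faithful_DJ_incl: "faithful X (DJ_incl X)"
  unfolding faithful_def
proof (intro ballI inj_onI)
  fix A B f g
  assume obj: "A \<in> Obj X" "B \<in> Obj X" and fg: "f \<in> Hom X A B" "g \<in> Hom X A B"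
    and eq: "DJ_incl X A B f = DJ_incl X A B g"
  have "f \<in> down X A B {g}" "g \<in> down X A B {f}"
    using eq obj fg subset_down[of A B "{f}"] subset_down[of A B "{g}"] by (auto simp: DJ_incl_def)
  then show "f = g"
    using obj fg rest_le_antisym[of A B f g] by (simp add: down_def)
qed

end

theorem proposition4p10:
  fixes X :: "('o, 'a) perp_cat"
  assumes "perp_restriction_category X"
  shows "disjoint_perp_restriction_category TYPE('i) (DJ X) \<and>
    (\<forall>A\<in>Obj X. \<forall>B\<in>Obj X. \<forall>(I :: 'i set) S.
      perp_family (DJ X) A B I S \<longrightarrow> is_perp_join (DJ X) A B I S (DJ_join X A B I S)) \<and>
    perp_restriction_functor X (DJ X) (\<lambda>A. A) (DJ_incl X) \<and>
    faithful X (DJ_incl X)"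
proof -
  interpret perp_restriction_category X
    by (rule assms)
  show ?thesis
    by (simp add: disjoint_perp_restriction_category_DJ is_perp_join_DJ_join
        perp_restriction_functor_DJ_incl faithful_DJ_incl)
qed

end
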